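(* Let $B$ be a real symmetric $4\times 4$ matrix that is not positive semidefinite and that spans an extreme ray of $(FW_3^4)^*$. Then there exist $a,c\in\,]-\pi,\pi[\,\setminus\{0\}$, a $4\times4$ permutation matrix $P$ and a nonsingular diagonal $4\times 4$ real matrix $D$ such that $$DPBP^{T}D=\begin{bmatrix} 1 & \cos(a) & \cos(a-c) & \cos(c)\\ \cos(a) & 1 & \cos(c) & \cos(a-c)\\ \cos(a-c) & \cos(c) & 1 & \cos(a)\\ \cos(c) & \cos(a-c) & \cos(a) & 1 \end{bmatrix}.$$
   Context: $\mathcal{S}^n$ denotes the space of real symmetric $n\times n$ matrices with inner product $\langle A,B\rangle=\operatorname{trace}(AB^T)=\sum_{i,j}A_{ij}B_{ij}$. The factor width of a real symmetric positive semidefinite $n\times n$ matrix $A$ is the smallest integer $k$ such that $A=VV^T$ for some real (rectangular) matrix $V$ each of whose columns has at most $k$ nonzero entries. $FW_k^n$ is the set of positive semidefinite $n\times n$ matrices of factor width at most $k$; it is a closed convex cone. Its dual cone is $(FW_k^n)^*=\{Y\in\mathcal{S}^n:\langle Y,X\rangle\ge 0\ \text{for all } X\in FW_k^n\}$. A nonzero element $A$ of a convex cone $C$ spans an extreme ray of $C$ if whenever $A=X+Y$ with $X,Y\in C$, both $X$ and $Y$ are nonnegative multiples of $A$. *)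

theory Defs
  imports Complex_Main "HOL-Combinatorics.Permutations" "Jordan_Normal_Form.Matrix"
begin

definition sym_mats :: "nat \<Rightarrow> real mat set" where
  "sym_mats n = {A \<in> carrier_mat n n. A\<^sup>T = A}"

definition psd_mats :: "nat \<Rightarrow> real mat set" where
  "psd_mats n = {A \<in> sym_mats n. \<forall>x \<in> carrier_vec n. x \<bullet> (A *\<^sub>v x) \<ge> 0}"

text \<open>The value is meaningful for matrices of equal dimensions.\<close>

definition mat_inner :: "real mat \<Rightarrow> real mat \<Rightarrow> real" where
  "mat_inner A B = (\<Sum>i<dim_row A. \<Sum>j<dim_col A. A $$ (i, j) * B $$ (i, j))"

text \<open>The number \<open>m\<close> of columns of the factor is unrestricted.\<close>

definition has_sparse_factor :: "nat \<Rightarrow> real mat \<Rightarrow> bool" where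
  "has_sparse_factor k A \<longleftrightarrow>
     (\<exists>m. \<exists>V \<in> carrier_mat (dim_row A) m.
        A = V * V\<^sup>T \<and> (\<forall>j<m. card {i. i < dim_row A \<and> V $$ (i, j) \<noteq> 0} \<le> k))"

text \<open>Only meaningful for positive semidefinite matrices: any other matrix has no factorization
  \<open>V * V\<^sup>T\<close> over the reals, and \<open>LEAST\<close> is then unspecified.\<close>

definition factor_width :: "real mat \<Rightarrow> nat" where
  "factor_width A = (LEAST k. has_sparse_factor k A)"

definition FW :: "nat \<Rightarrow> nat \<Rightarrow> real mat set" where
  "FW k n = {A \<in> psd_mats n. factor_width A \<le> k}"

definition dual_cone :: "nat \<Rightarrow> real mat set \<Rightarrow> real mat set" where
  "dual_cone n C = {Y \<in> sym_mats n. \<forall>X \<in> C. mat_inner Y X \<ge> 0}"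

definition spans_extreme_ray :: "real mat set \<Rightarrow> real mat \<Rightarrow> bool" where
  "spans_extreme_ray C A \<longleftrightarrow>
     A \<in> C \<and> A \<noteq> 0\<^sub>m (dim_row A) (dim_col A) \<and>
     (\<forall>X \<in> C. \<forall>Y \<in> C. A = X + Y \<longrightarrow>
        (\<exists>s\<ge>0. X = s \<cdot>\<^sub>m A) \<and> (\<exists>t\<ge>0. Y = t \<cdot>\<^sub>m A))"

definition permutation_mat :: "nat \<Rightarrow> real mat \<Rightarrow> bool" where
  "permutation_mat n P \<longleftrightarrow>
     (\<exists>p. p permutes {..<n} \<and> P = mat n n (\<lambda>(i, j). if j = p i then 1 else 0))"

end

theory Submission
  imports Defs "Jordan_Normal_Form.Determinant"
begin

text \<open>The dual cone consists of the symmetric matrices whose principal \<open>3 \<times> 3\<close> submatrices are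
  positive semidefinite. As \<open>B\<close> lies in it but is not positive semidefinite, \<open>B\<close> is invertible: a
  kernel vector with a nonzero \<open>j\<close>-th entry would allow every vector to be moved into the hyperplane
  \<open>x j = 0\<close> without changing the quadratic form. Extremality then forces the diagonal of the inverse
  \<open>A\<close> to vanish. After scaling the diagonal of \<open>B\<close> to \<open>1\<close>, the equations \<open>B A = 1\<close> show that the
  four triangle products \<open>a\<^sub>i\<^sub>j a\<^sub>j\<^sub>k a\<^sub>i\<^sub>k\<close> are equal and nonzero, hence opposite entries of \<open>A\<close> agree
  up to a common sign, and each entry of \<open>B\<close> is given by a law of cosines in the entries of \<open>A\<close>. No
  permutation is needed.\<close>

section \<open>Bilinear forms, Cauchy-Schwarz and Gram factorization\<close>

text \<open>Coefficients and vectors are functions on \<open>nat\<close>, so that an induction on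
  \<open>n\<close> can pass to a leading block without reindexing or carrier conditions.\<close>

definition bform :: "nat \<Rightarrow> (nat \<Rightarrow> nat \<Rightarrow> real) \<Rightarrow> (nat \<Rightarrow> real) \<Rightarrow> (nat \<Rightarrow> real) \<Rightarrow> real" where
  "bform n b x y = (\<Sum>i<n. \<Sum>j<n. b i j * x i * y j)"

lemma bform_commute:
  assumes "\<And>i j. i < n \<Longrightarrow> j < n \<Longrightarrow> b i j = b j i"
  shows "bform n b x y = bform n b y x"
  unfolding bform_def by (subst sum.swap) (auto intro!: sum.cong simp: assms)

lemma bform_unit:
  assumes "i < n" "j < n"
  shows "bform n b (\<lambda>l. if l = i then 1 else 0) (\<lambda>l. if l = j then 1 else 0) = b i j"
  using assms by (simp add: bform_def if_distrib[of "\<lambda>u. _ * u"] cong: if_cong)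

lemma bform_combination:
  assumes "\<And>i j. i < n \<Longrightarrow> j < n \<Longrightarrow> b i j = b j i"
  shows "bform n b (\<lambda>i. s * x i + t * y i) (\<lambda>i. s * x i + t * y i) =
    s\<^sup>2 * bform n b x x + 2 * s * t * bform n b x y + t\<^sup>2 * bform n b y y"
proof -
  have "bform n b (\<lambda>i. s * x i + t * y i) (\<lambda>i. s * x i + t * y i) =
    s\<^sup>2 * bform n b x x + s * t * bform n b x y + s * t * bform n b y x + t\<^sup>2 * bform n b y y"
    by (simp add: bform_def sum_distrib_left flip: sum.distrib)
      (simp add: algebra_simps power2_eq_square)
  then show ?thesis
    using bform_commute[of n b x y] assms by simp
qed

lemma nonneg_quadratic_imp_discriminant:
  fixes p q r :: real
  assumes "\<And>s t. 0 \<le> s\<^sup>2 * p + 2 * s * t * q + t\<^sup>2 * r"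
  shows "q\<^sup>2 \<le> p * r"
proof (cases "r = 0")
  case True
  have "0 \<le> p" using assms[of 1 0] by simp
  have "q = 0"
  proof (rule ccontr)
    assume "q \<noteq> 0"
    then show False
      \<comment> \<open>With \<open>r = 0\<close> and \<open>s = 1\<close> the form is affine in
        \<open>t\<close>; this \<open>t\<close> gives it the value \<open>-1\<close>.\<close>
      using assms[of 1 "- (p + 1) / (2 * q)"] True by (simp add: field_simps)
  qed
  then show ?thesis using True by simp
next
  case False
  have "0 \<le> r" using assms[of 0 1] by simp
  with False have "0 < r" by simp
  have "0 \<le> r\<^sup>2 * p + 2 * r * (- q) * q + (- q)\<^sup>2 * r" by (rule assms)
  also have "\<dots> = r * (p * r - q\<^sup>2)" by (simp add: algebra_simps power2_eq_square)
  finally show ?thesis using \<open>0 < r\<close> by (simp add: zero_le_mult_iff)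
qed

text \<open>Nonnegativity is required only on the span of \<open>x\<close> and \<open>y\<close>. The
  form of interest is indefinite, but nonnegative on each coordinate hyperplane.\<close>

lemma bform_Cauchy_Schwarz:
  assumes "\<And>i j. i < n \<Longrightarrow> j < n \<Longrightarrow> b i j = b j i"
    and "\<And>s t. 0 \<le> bform n b (\<lambda>i. s * x i + t * y i) (\<lambda>i. s * x i + t * y i)"
  shows "(bform n b x y)\<^sup>2 \<le> bform n b x x * bform n b y y"
  by (rule nonneg_quadratic_imp_discriminant)
    (use assms(2) in \<open>simp add: bform_combination[OF assms(1)]\<close>)

lemma bform_minus_rank_one:
  "bform n (\<lambda>i j. b i j - t * (f i * f j)) x x = bform n b x x - t * (\<Sum>i<n. f i * x i)\<^sup>2"
  by (simp add: bform_def power2_eq_square sum_product sum_distrib_left algebra_simps sum_subtractf)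

lemma bform_cong:
  assumes "\<And>i j. i < n \<Longrightarrow> j < n \<Longrightarrow> b i j = c i j" "\<And>i. i < n \<Longrightarrow> x i = x' i" "\<And>i. i < n \<Longrightarrow> y i = y' i"
  shows "bform n b x y = bform n c x' y'"
  unfolding bform_def using assms by (intro sum.cong) auto

lemma bform_rank_one:
  "bform n (\<lambda>i j. t * (f i * f j)) x x = t * (\<Sum>i<n. f i * x i)\<^sup>2"
  by (simp add: bform_def power2_eq_square sum_product sum_distrib_left algebra_simps)

lemma bform_right: "bform n b x y = (\<Sum>i<n. x i * (\<Sum>j<n. b i j * y j))"
  by (simp add: bform_def sum_distrib_left algebra_simps)

lemma bform_Suc:
  assumes "\<And>i. i < n \<Longrightarrow> b n i = b i n"
  shows "bform (Suc n) b x x =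
    bform n b x x + 2 * x n * (\<Sum>i<n. b i n * x i) + b n n * (x n)\<^sup>2"
proof -
  have "(\<Sum>i<n. b n i * x n * x i) = (\<Sum>i<n. b i n * x i * x n)"
    using assms by (intro sum.cong) auto
  then show ?thesis
    by (simp add: bform_def sum.distrib sum_distrib_left sum_distrib_right power2_eq_square
        algebra_simps)
qed

text \<open>The division by a vanishing pivot is harmless: it yields \<open>0\<close>, and then the whole pivot
  column vanishes.\<close>

lemma positive_semidefinite_factorization:
  assumes "\<And>i j. i < n \<Longrightarrow> j < n \<Longrightarrow> b i j = b j i"
    and "\<And>x. 0 \<le> bform n b x x"
  shows "\<exists>v. \<forall>i<n. \<forall>j<n. b i j = (\<Sum>k<n. v i k * v j k)"
  using assms
proof (induction n arbitrary: b)
  case 0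
  then show ?case by simp
next
  case (Suc n)
  note sym = Suc.prems(1) and psd = Suc.prems(2)
  define d where "d = b n n"
  \<comment> \<open>The Schur complement of the pivot \<open>d\<close>.\<close>
  define c where "c = (\<lambda>i j. b i j - 1 / d * (b i n * b j n))"
  have "0 \<le> d"
    using psd[of "\<lambda>l. if l = n then 1 else 0"] bform_unit[of n "Suc n" n b] by (simp add: d_def)
  have pivot: "b i n = 0" if "d = 0" "i < n" for i
    using bform_Cauchy_Schwarz[of "Suc n" b "\<lambda>l. if l = i then 1 else 0" "\<lambda>l. if l = n then 1 else 0"]
      sym psd that by (simp add: bform_unit d_def)
  have "0 \<le> bform n c x x" for x
  proof -
    define S where "S = (\<Sum>i<n. b i n * x i)"
    \<comment> \<open>For \<open>d > 0\<close> this last coordinate minimizes the form over all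
      extensions of \<open>x\<close>, and the minimum is the Schur complement at
      \<open>x\<close>.\<close>
    define z where "z = (\<lambda>i. if i = n then - S / d else x i)"
    have S: "(\<Sum>i<n. b i n * z i) = S"
      unfolding S_def z_def by (intro sum.cong) auto
    have z: "bform n b z z = bform n b x x"
      unfolding bform_def z_def by (intro sum.cong) auto
    have "bform (Suc n) b z z = bform n b x x + 2 * (- S / d) * S + d * (- S / d)\<^sup>2"
      using bform_Suc[of n b z] sym unfolding S z by (simp add: d_def z_def)
    also have "\<dots> = bform n c x x"
      unfolding c_def bform_minus_rank_one S_def[symmetric]
      by (cases "d = 0") (simp_all add: field_simps power2_eq_square)
    finally show ?thesis using psd[of z] by simp
  qed
  moreover have "c i j = c j i" if "i < n" "j < n" for i j
    using that sym by (simp add: c_def)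
  ultimately obtain v where v: "\<forall>i<n. \<forall>j<n. c i j = (\<Sum>k<n. v i k * v j k)"
    using Suc.IH by blast
  \<comment> \<open>One Cholesky step: the new column \<open>n\<close> is the pivot column divided
    by \<open>sqrt d\<close>, and the new row \<open>n\<close> is zero elsewhere.\<close>
  define w where "w = (\<lambda>i k. if k < n then (if i < n then v i k else 0)
    else (if i < n then b i n / sqrt d else sqrt d))"
  have "b i j = (\<Sum>k<Suc n. w i k * w j k)" if ij: "i < Suc n" "j < Suc n" for i j
  proof -
    consider "i < n" "j < n" | "i < n" "j = n" | "i = n" "j < n" | "i = n" "j = n"
      using ij unfolding less_Suc_eq by blast
    then show ?thesis
    proof cases
      case 1
      then have "(\<Sum>k<n. w i k * w j k) = c i j"
        using v by (simp add: w_def)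
      then show ?thesis
        using 1 \<open>0 \<le> d\<close> by (simp add: w_def c_def)
    next
      case 2
      then show ?thesis
        using \<open>0 \<le> d\<close> pivot[of i] by (cases "d = 0") (simp_all add: w_def)
    next
      case 3
      then show ?thesis
        using \<open>0 \<le> d\<close> pivot[of j] sym[of n j] by (cases "d = 0") (simp_all add: w_def)
    next
      case 4
      then show ?thesis
        using \<open>0 \<le> d\<close> by (simp add: w_def d_def)
    qed
  qed
  then show ?case by blast
qed

section \<open>Matrices as forms, and the dual cone of \<open>FW k n\<close>\<close>

abbreviation entries :: "real mat \<Rightarrow> nat \<Rightarrow> nat \<Rightarrow> real" where
  "entries A \<equiv> (\<lambda>i j. A $$ (i, j))"

lemma sym_mats_iff:
  "A \<in> sym_mats n \<longleftrightarrow> A \<in> carrier_mat n n \<and> (\<forall>i<n. \<forall>j<n. A $$ (i, j) = A $$ (j, i))"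
proof
  assume A: "A \<in> sym_mats n"
  then have "A \<in> carrier_mat n n" by (simp add: sym_mats_def)
  then have "A\<^sup>T $$ (i, j) = A $$ (j, i)" if "i < n" "j < n" for i j
    using that by simp
  then show "A \<in> carrier_mat n n \<and> (\<forall>i<n. \<forall>j<n. A $$ (i, j) = A $$ (j, i))"
    using A by (simp add: sym_mats_def)
qed (auto simp: sym_mats_def intro!: eq_matI)

lemma scalar_prod_mult_mat_vec:
  assumes "A \<in> carrier_mat n n" "x \<in> carrier_vec n"
  shows "x \<bullet> (A *\<^sub>v x) = bform n (entries A) (vec_index x) (vec_index x)"
  using assms by (simp add: bform_right scalar_prod_def lessThan_atLeast0)

lemma psd_mats_iff:
  "A \<in> psd_mats n \<longleftrightarrow> A \<in> sym_mats n \<and> (\<forall>x. 0 \<le> bform n (entries A) x x)"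
proof -
  have "0 \<le> bform n (entries A) x x"
    if A: "A \<in> sym_mats n" and "\<forall>x \<in> carrier_vec n. x \<bullet> (A *\<^sub>v x) \<ge> 0" for x
  proof -
    have "A \<in> carrier_mat n n" using A by (simp add: sym_mats_def)
    then have "vec n x \<bullet> (A *\<^sub>v vec n x) =
      bform n (entries A) (vec_index (vec n x)) (vec_index (vec n x))"
      by (rule scalar_prod_mult_mat_vec) simp
    then have "0 \<le> bform n (entries A) (vec_index (vec n x)) (vec_index (vec n x))"
      using that(2) by (metis vec_carrier)
    also have "\<dots> = bform n (entries A) x x"
      by (rule bform_cong) auto
    finally show ?thesis .
  qed
  then show ?thesis
    by (auto simp: psd_mats_def scalar_prod_mult_mat_vec sym_mats_iff)
qed

lemma has_sparse_factorI:
  fixes v :: "nat \<Rightarrow> nat \<Rightarrow> real" and m :: nat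
  assumes "X \<in> carrier_mat n n"
    and "\<And>i j. i < n \<Longrightarrow> j < n \<Longrightarrow> X $$ (i, j) = (\<Sum>l<m. v i l * v j l)"
    and "\<And>l. l < m \<Longrightarrow> card {i. i < n \<and> v i l \<noteq> 0} \<le> k"
  shows "has_sparse_factor k X"
proof -
  define V where "V = mat n m (\<lambda>(i, l). v i l)"
  have "X = V * V\<^sup>T"
    using assms(1,2) by (auto intro!: eq_matI simp: V_def scalar_prod_def lessThan_atLeast0)
  moreover have "card {i. i < n \<and> V $$ (i, l) \<noteq> 0} \<le> k" if "l < m" for l
  proof -
    have "{i. i < n \<and> V $$ (i, l) \<noteq> 0} = {i. i < n \<and> v i l \<noteq> 0}"
      using that by (auto simp: V_def)
    then show ?thesis using assms(3)[OF that] by simp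
  qed
  moreover have "V \<in> carrier_mat n m" by (simp add: V_def)
  ultimately show ?thesis
    unfolding has_sparse_factor_def using assms(1) by (auto intro!: exI[of _ m] bexI[of _ V])
qed

lemma has_sparse_factorE:
  assumes "has_sparse_factor k X" "X \<in> carrier_mat n n"
  obtains m :: nat and v :: "nat \<Rightarrow> nat \<Rightarrow> real"
    where "\<forall>i<n. \<forall>j<n. X $$ (i, j) = (\<Sum>l<m. v i l * v j l)"
    and "\<forall>l<m. card {i. i < n \<and> v i l \<noteq> 0} \<le> k"
proof -
  obtain m V where V: "V \<in> carrier_mat n m" "X = V * V\<^sup>T"
    "\<forall>j<m. card {i. i < n \<and> V $$ (i, j) \<noteq> 0} \<le> k"
    using assms unfolding has_sparse_factor_def by auto
  show thesis
  proof (rule that[of "entries V" m])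
    show "\<forall>i<n. \<forall>j<n. X $$ (i, j) = (\<Sum>l<m. V $$ (i, l) * V $$ (j, l))"
      using V(1,2) by (simp add: scalar_prod_def lessThan_atLeast0)
  qed (use V(3) in blast)
qed

text \<open>The \<open>LEAST\<close> in \<open>factor_width\<close> is attained, because a Gram
  factor with \<open>n\<close> rows exists and its columns trivially have at most \<open>n\<close>
  nonzero entries.\<close>

lemma has_sparse_factor_factor_width:
  assumes "X \<in> psd_mats n"
  shows "has_sparse_factor (factor_width X) X"
  unfolding factor_width_def
proof (rule LeastI)
  have X: "X \<in> carrier_mat n n" using assms by (simp add: psd_mats_iff sym_mats_iff)
  obtain v where v: "\<forall>i<n. \<forall>j<n. X $$ (i, j) = (\<Sum>k<n. v i k * v j k)"
    using assms positive_semidefinite_factorization[of n "entries X"]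
    by (auto simp: psd_mats_iff sym_mats_iff)
  have "card {i. i < n \<and> P i} \<le> n" for P
    using card_mono[of "{..<n}" "{i. i < n \<and> P i}"] by auto
  then show "has_sparse_factor n X"
    using v by (intro has_sparse_factorI[OF X, where m = n and v = v]) auto
qed

text \<open>The rank-one matrices of sparse vectors generate \<open>FW k n\<close>.\<close>

lemma dual_cone_FW_iff:
  "Y \<in> dual_cone n (FW k n) \<longleftrightarrow>
    Y \<in> sym_mats n \<and> (\<forall>x. card {i. i < n \<and> x i \<noteq> 0} \<le> k \<longrightarrow> 0 \<le> bform n (entries Y) x x)"
proof (cases "Y \<in> sym_mats n")
  case True
  then have inner: "mat_inner Y X = (\<Sum>i<n. \<Sum>j<n. Y $$ (i, j) * X $$ (i, j))" for X
    by (auto simp: mat_inner_def sym_mats_iff)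
  have "0 \<le> bform n (entries Y) x x"
    if Y: "\<forall>X \<in> FW k n. mat_inner Y X \<ge> 0" and x: "card {i. i < n \<and> x i \<noteq> 0} \<le> k" for x
  proof -
    define X where "X = mat n n (\<lambda>(i, j). x i * x j)"
    have X: "X \<in> carrier_mat n n" by (simp add: X_def)
    have "has_sparse_factor k X"
      using x by (intro has_sparse_factorI[OF X, where m = 1 and v = "\<lambda>i l. x i"]) (auto simp: X_def)
    then have "factor_width X \<le> k"
      unfolding factor_width_def by (rule Least_le)
    moreover have "bform n (entries X) y y = (\<Sum>i<n. x i * y i)\<^sup>2" for y
      using bform_rank_one[of n 1 x y] by (simp add: X_def bform_def)
    ultimately have "X \<in> FW k n"
      by (simp add: FW_def psd_mats_iff sym_mats_iff) (simp add: X_def)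
    then have "0 \<le> mat_inner Y X" using Y by blast
    also have "mat_inner Y X = bform n (entries Y) x x"
      unfolding inner by (simp add: X_def bform_def algebra_simps)
    finally show ?thesis .
  qed
  moreover have "0 \<le> mat_inner Y X"
    if Y: "\<forall>x. card {i. i < n \<and> x i \<noteq> 0} \<le> k \<longrightarrow> 0 \<le> bform n (entries Y) x x"
      and FW: "X \<in> FW k n" for X
  proof -
    have X: "X \<in> carrier_mat n n" "has_sparse_factor (factor_width X) X" "factor_width X \<le> k"
      using FW has_sparse_factor_factor_width by (auto simp: FW_def psd_mats_iff sym_mats_iff)
    obtain m :: nat and v :: "nat \<Rightarrow> nat \<Rightarrow> real"
      where v: "\<forall>i<n. \<forall>j<n. X $$ (i, j) = (\<Sum>l<m. v i l * v j l)"
        "\<forall>l<m. card {i. i < n \<and> v i l \<noteq> 0} \<le> factor_width X"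
      by (rule has_sparse_factorE[OF X(2,1)], rule that)
    have "mat_inner Y X = (\<Sum>i<n. \<Sum>j<n. \<Sum>l<m. Y $$ (i, j) * v i l * v j l)"
      unfolding inner using v(1)
      by (intro sum.cong refl) (simp add: sum_distrib_left mult.assoc)
    also have "\<dots> = (\<Sum>i<n. \<Sum>l<m. \<Sum>j<n. Y $$ (i, j) * v i l * v j l)"
      by (intro sum.cong refl sum.swap)
    also have "\<dots> = (\<Sum>l<m. bform n (entries Y) (\<lambda>i. v i l) (\<lambda>i. v i l))"
      unfolding bform_def by (rule sum.swap)
    also have "0 \<le> \<dots>"
      using Y v(2) \<open>factor_width X \<le> k\<close> by (intro sum_nonneg) (auto intro: le_trans)
    finally show ?thesis .
  qed
  ultimately show ?thesis
    using True by (auto simp: dual_cone_def)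
qed (simp add: dual_cone_def)

text \<open>Having at most \<open>m\<close> nonzero entries among \<open>Suc m\<close> means having
  a vanishing one. Thus all principal submatrices of order \<open>m\<close> are positive
  semidefinite.\<close>

lemma dual_cone_FW_corank_one_iff:
  "Y \<in> dual_cone (Suc m) (FW m (Suc m)) \<longleftrightarrow>
    Y \<in> sym_mats (Suc m) \<and>
    (\<forall>i<Suc m. \<forall>x. x i = 0 \<longrightarrow> 0 \<le> bform (Suc m) (entries Y) x x)"
proof -
  have "card {i. i < Suc m \<and> x i \<noteq> 0} \<le> m \<longleftrightarrow> (\<exists>i<Suc m. x i = 0)" for x :: "nat \<Rightarrow> real"
  proof
    assume "card {i. i < Suc m \<and> x i \<noteq> 0} \<le> m"
    then have "{i. i < Suc m \<and> x i \<noteq> 0} \<noteq> {..<Suc m}" by (metis card_lessThan not_less_eq_eq order_refl)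
    then show "\<exists>i<Suc m. x i = 0" by blast
  next
    assume "\<exists>i<Suc m. x i = 0"
    then have "{i. i < Suc m \<and> x i \<noteq> 0} \<subset> {..<Suc m}" by blast
    then have "card {i. i < Suc m \<and> x i \<noteq> 0} < card {..<Suc m}"
      by (intro psubset_card_mono) auto
    then show "card {i. i < Suc m \<and> x i \<noteq> 0} \<le> m" by simp
  qed
  then show ?thesis
    unfolding dual_cone_FW_iff by blast
qed

section \<open>Symmetric inverses, and the algebra and trigonometry of the hollow case\<close>

lemma symmetric_inverse_exists:
  fixes B :: "real mat"
  assumes "B \<in> sym_mats n"
    and "\<And>v. (\<And>i. i < n \<Longrightarrow> (\<Sum>j<n. B $$ (i, j) * v j) = 0) \<Longrightarrow> (\<And>j. j < n \<Longrightarrow> v j = 0)"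
  obtains A where "A \<in> sym_mats n" "B * A = 1\<^sub>m n"
proof -
  have B: "B \<in> carrier_mat n n" and BT: "B\<^sup>T = B" using assms(1) by (auto simp: sym_mats_def)
  have "det B \<noteq> 0"
  proof
    assume "det B = 0"
    then obtain v where v: "v \<in> carrier_vec n" "v \<noteq> 0\<^sub>v n" "B *\<^sub>v v = 0\<^sub>v n"
      using det_0_iff_vec_prod_zero[OF B] by blast
    have "(\<Sum>j<n. B $$ (i, j) * v $ j) = 0" if "i < n" for i
    proof -
      have "(B *\<^sub>v v) $ i = 0" using v(3) that by simp
      then show ?thesis using that v(1) B by (simp add: scalar_prod_def lessThan_atLeast0)
    qed
    then have "v $ j = 0" if "j < n" for j using assms(2)[of "vec_index v"] that by blast
    then show False using v(1,2) by (auto intro: eq_vecI)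
  qed
  then obtain A where A: "A \<in> carrier_mat n n" "B * A = 1\<^sub>m n"
    using det_non_zero_imp_unit[OF B, where b = "()"] B
    by (auto simp: Units_def ring_mat_def)
  \<comment> \<open>Transposing \<open>B * A = 1\<close> makes the transpose of \<open>A\<close> a
    left inverse, which must coincide with the right inverse \<open>A\<close>.\<close>
  have "A\<^sup>T * B = 1\<^sub>m n"
    using transpose_mult[OF B A(1)] A(2) BT by simp
  then have "A\<^sup>T = A"
    using A B assoc_mult_mat[of "A\<^sup>T" n n B n A n] by simp
  then show ?thesis using that[of A] A by (simp add: sym_mats_def)
qed

text \<open>The sixteen equations are the entries of \<open>B A = 1\<close> for symmetric
  \<open>B\<close> with unit diagonal and symmetric \<open>A\<close> with zero diagonal. The last
  equation of the conclusion says that the principal minor of \<open>B\<close> on the indices 2, 3,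
  4 vanishes.\<close>

lemma unit_diagonal_with_hollow_inverse:
  fixes b12 b13 b14 b23 b24 b34 a12 a13 a14 a23 a24 a34 :: real
  assumes inv: "b12 * a12 + b13 * a13 + b14 * a14 = 1"
    "a12 + b13 * a23 + b14 * a24 = 0"
    "a13 + b12 * a23 + b14 * a34 = 0"
    "a14 + b12 * a24 + b13 * a34 = 0"
    "a12 + b23 * a13 + b24 * a14 = 0"
    "b12 * a12 + b23 * a23 + b24 * a24 = 1"
    "b12 * a13 + a23 + b24 * a34 = 0"
    "b12 * a14 + a24 + b23 * a34 = 0"
    "a13 + b23 * a12 + b34 * a14 = 0"
    "b13 * a12 + a23 + b34 * a24 = 0"
    "b13 * a13 + b23 * a23 + b34 * a34 = 1"
    "b13 * a14 + b23 * a24 + a34 = 0"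
    "a14 + b24 * a12 + b34 * a13 = 0"
    "b14 * a12 + a24 + b34 * a23 = 0"
    "b14 * a13 + b24 * a23 + a34 = 0"
    "b14 * a14 + b24 * a24 + b34 * a34 = 1"
    and le1: "b34\<^sup>2 \<le> 1" "b23\<^sup>2 \<le> 1"
  shows "\<exists>e. (e = 1 \<or> e = - 1) \<and> b12 = e * b34 \<and> b13 = e * b24 \<and> b14 = e * b23 \<and>
    b34\<^sup>2 < 1 \<and> b23\<^sup>2 < 1 \<and> (b24 - b34 * b23)\<^sup>2 = (1 - b34\<^sup>2) * (1 - b23\<^sup>2)"
proof -
  \<comment> \<open>\<open>p\<close> is the determinant of \<open>A\<close>. The cofactor of a
    diagonal entry of \<open>A\<close> is twice a triangle product, and the diagonal of the inverse
    \<open>B\<close> is \<open>1\<close>; this is the source of \<open>T\<close>.\<close>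
  define p where "p = (a12 * a34)\<^sup>2 + (a13 * a24)\<^sup>2 + (a14 * a23)\<^sup>2
    - 2 * (a12 * a34) * (a13 * a24) - 2 * (a12 * a34) * (a14 * a23) - 2 * (a13 * a24) * (a14 * a23)"
  have T: "2 * (a23 * a24 * a34) = p" "2 * (a13 * a14 * a34) = p"
    "2 * (a12 * a14 * a24) = p" "2 * (a12 * a13 * a23) = p"
    using inv unfolding p_def by Groebner_Basis.algebra+
  have "p \<noteq> 0"
  proof
    assume "p = 0"
    then have "a23 * a24 * a34 = 0" using T(1) by simp
    then show False using inv by Groebner_Basis.algebra
  qed
  then have nz: "a12 \<noteq> 0" "a13 \<noteq> 0" "a14 \<noteq> 0" "a23 \<noteq> 0" "a24 \<noteq> 0" "a34 \<noteq> 0"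
    using T by auto
  define e where "e = a12 / a34"
  have a12: "a12 = e * a34" using nz by (simp add: e_def)
  \<comment> \<open>Two triangle products sharing an edge are compared and that edge is cancelled,
    which gives all opposite pairs the same ratio \<open>e\<close>.\<close>
  have "(2 * a13) * (a14 * a34) = (2 * a13) * (a12 * a23)"
    "(2 * a14) * (a13 * a34) = (2 * a14) * (a12 * a24)"
    using T(2) T(3)[symmetric] T(4)[symmetric] by (simp_all only: ac_simps)
  then have "a14 * a34 = a12 * a23" "a13 * a34 = a12 * a24"
    using nz by simp_all
  then have a14: "a14 = e * a23" and a13: "a13 = e * a24"
    using nz by (simp_all add: e_def field_simps)
  have "e \<noteq> 0" using nz by (simp add: e_def)
  have "a13 * a14 * a34 = a23 * a24 * a34"
    using T(1,2) by linarith
  then have "e\<^sup>2 * (a23 * a24 * a34) = 1 * (a23 * a24 * a34)"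
    unfolding a13 a14 by (simp only: power2_eq_square ac_simps mult_1)
  then have e2: "e\<^sup>2 = 1" using nz by simp
  \<comment> \<open>The first column of \<open>B A = 1\<close> below the diagonal, divided by
    \<open>e\<close>: a linear system for \<open>b23\<close>, \<open>b24\<close>,
    \<open>b34\<close>.\<close>
  have row: "a34 + b23 * a24 + b24 * a23 = 0" "a24 + b23 * a34 + b34 * a23 = 0"
    "a23 + b24 * a34 + b34 * a24 = 0"
    using inv(5,9,13) \<open>e \<noteq> 0\<close> unfolding a12 a13 a14 by Groebner_Basis.algebra+
  have row': "e * a34 + b13 * a23 + b14 * a24 = 0" "e * a24 + b12 * a23 + b14 * a34 = 0"
    "e * a23 + b12 * a24 + b13 * a34 = 0"
    using inv(2-4) unfolding a12 a13 a14 by simp_all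
  have cosine_law: "2 * a23 * a24 * b34 = a34\<^sup>2 - a23\<^sup>2 - a24\<^sup>2"
    "2 * a23 * a34 * b24 = a24\<^sup>2 - a23\<^sup>2 - a34\<^sup>2"
    "2 * a24 * a34 * b23 = a23\<^sup>2 - a24\<^sup>2 - a34\<^sup>2"
    using row by Groebner_Basis.algebra+
  have "2 * a23 * a24 * (b12 - e * b34) = 0" "2 * a23 * a34 * (b13 - e * b24) = 0"
    "2 * a24 * a34 * (b14 - e * b23) = 0"
    using cosine_law row' by Groebner_Basis.algebra+
  then have b: "b12 = e * b34" "b13 = e * b24" "b14 = e * b23"
    using nz by simp_all
  \<comment> \<open>Heron's formula: both sides are sixteen times the squared area of a triangle
    with sides \<open>a23\<close>, \<open>a24\<close>, \<open>a34\<close>. As \<open>p\<close> is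
    nonzero, the cosines differ from 1 and -1.\<close>
  have "(2 * a23 * a24)\<^sup>2 * (1 - b34\<^sup>2) = - p" "(2 * a24 * a34)\<^sup>2 * (1 - b23\<^sup>2) = - p"
    using cosine_law e2 unfolding p_def a12 a13 a14 by Groebner_Basis.algebra+
  then have "b34\<^sup>2 \<noteq> 1" "b23\<^sup>2 \<noteq> 1" using \<open>p \<noteq> 0\<close> by auto
  with le1 have lt1: "b34\<^sup>2 < 1" "b23\<^sup>2 < 1" by simp_all
  \<comment> \<open>The squared factor clears the denominators of the law of cosines.\<close>
  have "(4 * a23 * a24\<^sup>2 * a34)\<^sup>2 * ((b24 - b34 * b23)\<^sup>2 - (1 - b34\<^sup>2) * (1 - b23\<^sup>2)) = 0"
    using cosine_law by Groebner_Basis.algebra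
  then have "(b24 - b34 * b23)\<^sup>2 = (1 - b34\<^sup>2) * (1 - b23\<^sup>2)" using nz by simp
  moreover have "e = 1 \<or> e = - 1" using e2 by (simp add: power2_eq_1_iff)
  ultimately show ?thesis using b lt1 by blast
qed

text \<open>The hypothesis says that \<open>y - x * z\<close> is plus or minus the product of the
  sines of \<open>arccos x\<close> and \<open>arccos z\<close>; the sign is absorbed by taking
  \<open>c\<close> to be \<open>arccos z\<close> or its negative.\<close>

lemma arccos_parametrization:
  fixes x y z :: real
  assumes "x\<^sup>2 < 1" "z\<^sup>2 < 1" "(y - x * z)\<^sup>2 = (1 - x\<^sup>2) * (1 - z\<^sup>2)"
  shows "\<exists>a \<in> {-pi<..<pi} - {0}. \<exists>c \<in> {-pi<..<pi} - {0}. x = cos a \<and> z = cos c \<and> y = cos (a - c)"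
proof -
  have x: "- 1 < x" "x < 1" and z: "- 1 < z" "z < 1"
    using assms(1,2) by (simp_all add: power2_less_1_iff abs_less_iff)
  define a where "a = arccos x"
  define g where "g = arccos z"
  have a: "0 < a" "a < pi" "cos a = x" and g: "0 < g" "g < pi" "cos g = z"
    using x z arccos_lt_bounded[of x] arccos_lt_bounded[of z] by (simp_all add: a_def g_def)
  have "(y - x * z)\<^sup>2 = (sin a * sin g)\<^sup>2"
    using assms(3) by (simp add: power_mult_distrib sin_squared_eq a(3) g(3))
  then have "y - x * z = sin a * sin g \<or> y - x * z = - (sin a * sin g)"
    by (simp add: power2_eq_iff)
  then have "y = cos (a - g) \<or> y = cos (a - - g)"
    by (auto simp: cos_diff cos_add a(3) g(3))
  moreover have "a \<in> {-pi<..<pi} - {0}" "g \<in> {-pi<..<pi} - {0}" "- g \<in> {-pi<..<pi} - {0}"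
    "cos (- g) = z"
    using a g by auto
  ultimately show ?thesis using a(3) g(3) by metis
qed

section \<open>Forms that are nonnegative on every coordinate hyperplane\<close>

text \<open>For \<open>3 \<le> n\<close> some coordinate \<open>l\<close> differs from
  \<open>i\<close> and \<open>j\<close>, so the span of the two unit vectors lies in the hyperplane
  \<open>x l = 0\<close>, where Cauchy-Schwarz applies.\<close>

lemma bform_square_le_diagonal:
  fixes b :: "nat \<Rightarrow> nat \<Rightarrow> real"
  assumes sym: "\<And>i j. i < n \<Longrightarrow> j < n \<Longrightarrow> b i j = b j i"
    and pos: "\<And>l x. l < n \<Longrightarrow> x l = 0 \<Longrightarrow> 0 \<le> bform n b x x"
    and "3 \<le> n" "i < n" "j < n"
  shows "(b i j)\<^sup>2 \<le> b i i * b j j"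
proof -
  have "card {i, j} < card {..<n}"
    using \<open>3 \<le> n\<close> card_insert_le_m1[of 2 "{j}" i] by simp
  then have "\<not> {..<n} \<subseteq> {i, j}"
    by (metis card_mono finite.emptyI finite.insertI leD)
  then obtain l where l: "l < n" "l \<noteq> i" "l \<noteq> j" by blast
  let ?u = "\<lambda>k l. if l = k then 1 else 0 :: real"
  have "(bform n b (?u i) (?u j))\<^sup>2 \<le> bform n b (?u i) (?u i) * bform n b (?u j) (?u j)"
  proof (rule bform_Cauchy_Schwarz)
    show "0 \<le> bform n b (\<lambda>k. s * ?u i k + t * ?u j k) (\<lambda>k. s * ?u i k + t * ?u j k)" for s t
      by (rule pos[OF l(1)]) (use l in simp)
  qed (rule sym)
  then show ?thesis
    using \<open>i < n\<close> \<open>j < n\<close> by (simp only: bform_unit)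
qed

lemma kernel_trivial:
  fixes b :: "nat \<Rightarrow> nat \<Rightarrow> real"
  assumes sym: "\<And>i j. i < n \<Longrightarrow> j < n \<Longrightarrow> b i j = b j i"
    and pos: "\<And>l x. l < n \<Longrightarrow> x l = 0 \<Longrightarrow> 0 \<le> bform n b x x"
    and neg: "bform n b x0 x0 < 0"
    and ker: "\<And>i. i < n \<Longrightarrow> (\<Sum>j<n. b i j * v j) = 0" and "j < n"
  shows "v j = 0"
proof (rule ccontr)
  assume "v j \<noteq> 0"
  \<comment> \<open>The multiple of \<open>v\<close> is chosen to make \<open>y j\<close>
    vanish.\<close>
  define y where "y = (\<lambda>i. 1 * x0 i + (- x0 j / v j) * v i)"
  have "bform n b x v = 0" for x
    unfolding bform_right by (simp add: ker)
  then have "bform n b y y = bform n b x0 x0"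
    unfolding y_def by (subst bform_combination[OF sym]) auto
  moreover have "0 \<le> bform n b y y"
    using \<open>v j \<noteq> 0\<close> by (intro pos[OF \<open>j < n\<close>]) (simp add: y_def)
  ultimately show False using neg by simp
qed

text \<open>If \<open>A $$ (i, i) \<noteq> 0\<close>, then some \<open>w\<close> with \<open>w i = 0\<close> represents the linear form given by the
  \<open>i\<close>-th column \<open>f\<close> of \<open>B\<close> on the hyperplane \<open>x i = 0\<close>. By Cauchy-Schwarz, a small multiple of
  \<open>f f\<^sup>T\<close> can be subtracted from \<open>B\<close> within the dual cone, so \<open>B\<close> would be proportional to \<open>f f\<^sup>T\<close>.\<close>

lemma extreme_ray_inverse_diagonal:
  assumes ext: "spans_extreme_ray (dual_cone (Suc m) (FW m (Suc m))) B"
    and neg: "bform (Suc m) (entries B) x0 x0 < 0"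
    and A: "A \<in> carrier_mat (Suc m) (Suc m)" "B * A = 1\<^sub>m (Suc m)"
    and i: "i < Suc m" and diag: "0 < B $$ (i, i)"
  shows "A $$ (i, i) = 0"
proof (rule ccontr)
  assume Aii: "A $$ (i, i) \<noteq> 0"
  define n where "n = Suc m"
  define K where "K = dual_cone n (FW m n)"
  define Q where "Q = bform n (entries B)"
  have K_iff: "Y \<in> K \<longleftrightarrow> Y \<in> sym_mats n \<and> (\<forall>i<n. \<forall>x. x i = 0 \<longrightarrow> 0 \<le> bform n (entries Y) x x)" for Y
    unfolding K_def n_def by (rule dual_cone_FW_corank_one_iff)
  have "B \<in> K" using ext by (simp add: spans_extreme_ray_def K_def n_def)
  then have B: "B \<in> carrier_mat n n"
    and sym: "\<And>i j. i < n \<Longrightarrow> j < n \<Longrightarrow> B $$ (i, j) = B $$ (j, i)"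
    and pos: "\<And>l x. l < n \<Longrightarrow> x l = 0 \<Longrightarrow> 0 \<le> Q x x"
    unfolding K_iff sym_mats_iff Q_def by auto
  have "i < n" using i by (simp add: n_def)
  have CS: "(Q x y)\<^sup>2 \<le> Q x x * Q y y" if "l < n" "x l = 0" "y l = 0" for l x y
    unfolding Q_def
    by (rule bform_Cauchy_Schwarz[of n "entries B"]) (use sym pos[OF that(1)] that in \<open>auto simp: Q_def\<close>)
  have inv: "(\<Sum>k<n. B $$ (j, k) * A $$ (k, i)) = (if j = i then 1 else 0)" if "j < n" for j
  proof -
    have "(B * A) $$ (j, i) = (if j = i then 1 else 0)"
      using A that \<open>i < n\<close> by (simp add: n_def)
    then show ?thesis
      using that \<open>i < n\<close> A(1) B by (simp add: scalar_prod_def lessThan_atLeast0 n_def)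
  qed
  define f where "f = (\<lambda>j. B $$ (j, i))"
  define L where "L = (\<lambda>x. \<Sum>j<n. f j * x j)"
  \<comment> \<open>The unit vector represents \<open>L\<close>, and the \<open>i\<close>-th column
    of \<open>A\<close> represents \<open>x i\<close>. Their combination has \<open>w i = 0\<close>
    and still represents \<open>L\<close> where \<open>x i = 0\<close>.\<close>
  define w where "w = (\<lambda>j. (if j = i then 1 else 0) - A $$ (j, i) / A $$ (i, i))"
  have Q_unit: "Q x (\<lambda>j. if j = i then 1 else 0) = L x" for x
    using \<open>i < n\<close> by (simp add: Q_def bform_right L_def f_def if_distrib[of "\<lambda>u. _ * u"] mult.commute cong: if_cong)
  have Q_column: "Q x (\<lambda>j. A $$ (j, i)) = x i" for x
    using \<open>i < n\<close> by (simp add: Q_def bform_right inv if_distrib[of "\<lambda>u. _ * u"] cong: if_cong)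
  have "Q x w = L x - x i / A $$ (i, i)" for x
  proof -
    have "Q x w = Q x (\<lambda>j. if j = i then 1 else 0) - Q x (\<lambda>j. A $$ (j, i)) / A $$ (i, i)"
      by (simp only: Q_def bform_def w_def right_diff_distrib sum_subtractf sum_divide_distrib
          times_divide_eq_right)
    then show ?thesis by (simp add: Q_unit Q_column)
  qed
  then have Q_w: "Q x w = L x" if "x i = 0" for x using that by simp
  have "w i = 0" using Aii by (simp add: w_def)
  then have "0 \<le> Q w w" using pos[OF \<open>i < n\<close>] by blast
  \<comment> \<open>The two bounds serve the hyperplane \<open>x i = 0\<close>, with
    \<open>w\<close> as Cauchy-Schwarz partner, and the other hyperplanes, with the
    \<open>i\<close>-th unit vector. The \<open>+ 1\<close> covers \<open>Q w w = 0\<close>.\<close>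
  define t where "t = min (1 / B $$ (i, i)) (1 / (Q w w + 1))"
  have "0 < t" using diag \<open>0 \<le> Q w w\<close> by (simp add: t_def)
  have bound: "t * (L x)\<^sup>2 \<le> Q x x" if l: "l < n" "x l = 0" for l x
  proof -
    have Qx: "0 \<le> Q x x" using pos l by blast
    obtain c where "(L x)\<^sup>2 \<le> Q x x * c" "0 \<le> c" "t * c \<le> 1"
    proof (cases "l = i")
      case True
      have Lx: "(L x)\<^sup>2 \<le> Q x x * Q w w"
        using CS[of i x w] Q_w[of x] \<open>w i = 0\<close> l True by simp
      have "t * Q w w \<le> 1 / (Q w w + 1) * Q w w"
        by (rule mult_right_mono) (simp_all add: t_def \<open>0 \<le> Q w w\<close>)
      moreover have "1 / (Q w w + 1) * Q w w \<le> 1" using \<open>0 \<le> Q w w\<close> by simp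
      ultimately have "t * Q w w \<le> 1" by linarith
      with Lx show thesis using that \<open>0 \<le> Q w w\<close> by blast
    next
      case False
      have "Q (\<lambda>j. if j = i then 1 else 0) (\<lambda>j. if j = i then 1 else 0) = B $$ (i, i)"
        unfolding Q_def by (rule bform_unit[OF \<open>i < n\<close> \<open>i < n\<close>])
      then have "(L x)\<^sup>2 \<le> Q x x * B $$ (i, i)"
        using CS[of l x "\<lambda>j. if j = i then 1 else 0"] l False
        by (metis Q_unit)
      moreover have "t * B $$ (i, i) \<le> 1 / B $$ (i, i) * B $$ (i, i)"
        by (rule mult_right_mono) (use diag in \<open>simp_all add: t_def\<close>)
      then have "t * B $$ (i, i) \<le> 1" using diag by simp
      ultimately show thesis using that diag by (meson less_imp_le)
    qed
    then have "t * (L x)\<^sup>2 \<le> t * (Q x x * c)" using \<open>0 < t\<close> by simp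
    also have "\<dots> = Q x x * (t * c)" by simp
    also have "\<dots> \<le> Q x x" using Qx \<open>t * c \<le> 1\<close> by (simp add: mult_left_le)
    finally show ?thesis .
  qed
  define X where "X = mat n n (\<lambda>(j, k). B $$ (j, k) - t * (f j * f k))"
  define Y where "Y = mat n n (\<lambda>(j, k). t * (f j * f k))"
  have form_X: "bform n (entries X) x x = Q x x - t * (L x)\<^sup>2" for x
    unfolding Q_def L_def bform_minus_rank_one[symmetric] by (rule bform_cong) (auto simp: X_def)
  have form_Y: "bform n (entries Y) x x = t * (L x)\<^sup>2" for x
    unfolding L_def bform_rank_one[symmetric] by (rule bform_cong) (auto simp: Y_def)
  have "X \<in> K" unfolding K_iff form_X
    using bound sym by (auto simp: X_def sym_mats_iff)
  moreover have "Y \<in> K" unfolding K_iff form_Y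
    using \<open>0 < t\<close> by (auto simp: Y_def sym_mats_iff)
  moreover have "B = X + Y"
    using B by (auto intro!: eq_matI simp: X_def Y_def)
  ultimately obtain s where s: "0 \<le> s" "Y = s \<cdot>\<^sub>m B"
    using ext unfolding spans_extreme_ray_def K_def n_def by blast
  have "Y $$ (i, i) = s * B $$ (i, i)"
    unfolding s(2) using B \<open>i < n\<close> by simp
  then have "s \<noteq> 0" using \<open>0 < t\<close> diag \<open>i < n\<close> by (auto simp: Y_def f_def)
  \<comment> \<open>The contradiction: a positive multiple of \<open>B\<close> is negative at
    \<open>x0\<close>, while the form of \<open>Y\<close> is a nonnegative multiple of a
    square.\<close>
  have "bform n (entries Y) x0 x0 = bform n (\<lambda>j k. s * B $$ (j, k)) x0 x0"
    unfolding s(2) by (rule bform_cong) (use B in auto)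
  also have "\<dots> = s * Q x0 x0"
    by (simp add: Q_def bform_def sum_distrib_left mult.assoc)
  finally have "s * Q x0 x0 = t * (L x0)\<^sup>2" unfolding form_Y by simp
  moreover have "s * Q x0 x0 < 0"
    using s(1) \<open>s \<noteq> 0\<close> neg by (simp add: Q_def n_def mult_pos_neg)
  moreover have "0 \<le> t * (L x0)\<^sup>2" using \<open>0 < t\<close> by simp
  ultimately show False by simp
qed

section \<open>Normalization of \<open>B\<close> and recovery of the angles\<close>

theorem proposition4p5:
  fixes B :: "real mat"
  assumes "B \<in> sym_mats 4"
    and "B \<notin> psd_mats 4"
    and "spans_extreme_ray (dual_cone 4 (FW 3 4)) B"
  shows "\<exists>a \<in> {-pi<..<pi} - {0}. \<exists>c \<in> {-pi<..<pi} - {0}. \<exists>P D.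
    permutation_mat 4 P \<and>
    D \<in> carrier_mat 4 4 \<and> diagonal_mat D \<and> invertible_mat D \<and>
    D * P * B * P\<^sup>T * D = mat_of_rows_list 4
      [[1,           cos a,       cos (a - c), cos c],
       [cos a,       1,           cos c,       cos (a - c)],
       [cos (a - c), cos c,       1,           cos a],
       [cos c,       cos (a - c), cos a,       1]]"
proof -
  have four: "Suc 3 = 4" by simp
  have B: "B \<in> carrier_mat 4 4"
    and sym: "\<And>i j. i < 4 \<Longrightarrow> j < 4 \<Longrightarrow> B $$ (i, j) = B $$ (j, i)"
    using assms(1) by (auto simp: sym_mats_iff)
  have "B \<in> dual_cone (Suc 3) (FW 3 (Suc 3))"
    using assms(3) unfolding spans_extreme_ray_def four by blast
  then have pos: "\<And>l x. l < 4 \<Longrightarrow> x l = 0 \<Longrightarrow> 0 \<le> bform 4 (entries B) x x"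
    unfolding dual_cone_FW_corank_one_iff unfolding four by blast
  obtain x0 where neg: "bform 4 (entries B) x0 x0 < 0"
    using assms(1,2) unfolding psd_mats_iff by (auto simp: not_le)
  have kernel: "v j = 0" if "\<And>i. i < 4 \<Longrightarrow> (\<Sum>j<4. B $$ (i, j) * v j) = 0" "j < 4" for v j
    by (rule kernel_trivial[of 4 "entries B" x0 v]) (fact sym pos neg that)+
  obtain A where A: "A \<in> sym_mats 4" "B * A = 1\<^sub>m 4"
    by (rule symmetric_inverse_exists[OF assms(1)]) (rule kernel)
  have A4: "A \<in> carrier_mat 4 4" and symA: "\<And>i j. i < 4 \<Longrightarrow> j < 4 \<Longrightarrow> A $$ (i, j) = A $$ (j, i)"
    using A(1) by (auto simp: sym_mats_iff)
  have minors: "(B $$ (i, j))\<^sup>2 \<le> B $$ (i, i) * B $$ (j, j)" if "i < 4" "j < 4" for i j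
    by (rule bform_square_le_diagonal[of 4 "entries B"]) (fact sym pos that | simp)+
  have diag: "0 < B $$ (i, i)" if i: "i < 4" for i
  proof -
    obtain l :: nat where l: "l < 4" "l \<noteq> i"
      by (cases "i = 0") (auto intro: that[of 1] that[of 0])
    have "0 \<le> B $$ (i, i)"
      using pos[of l "\<lambda>j. if j = i then 1 else 0"] l bform_unit[OF i i] by simp
    moreover have "B $$ (i, i) \<noteq> 0"
    \<comment> \<open>A zero diagonal entry would annihilate its column by \<open>minors\<close>,
      putting a unit vector into the kernel.\<close>
    proof
      assume "B $$ (i, i) = 0"
      then have "B $$ (j, i) = 0" if "j < 4" for j
        using minors[OF that i] by simp
      then have "(\<Sum>k<4. B $$ (j, k) * (if k = i then 1 else 0)) = 0" if "j < 4" for j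
        using that i by (simp add: if_distrib[of "\<lambda>u. _ * u"] cong: if_cong)
      then show False
        using kernel[of "\<lambda>k. if k = i then 1 else 0" i] i by simp
    qed
    ultimately show ?thesis by simp
  qed
  have hollow: "A $$ (i, i) = 0" if "i < 4" for i
    using extreme_ray_inverse_diagonal[of 3 B x0 A i] assms(3) neg A4 A(2) that diag[OF that]
    by (simp only: four)
  \<comment> \<open>Scaling by \<open>s\<close> gives \<open>b\<close> a unit diagonal; the inverse
    scaling keeps \<open>a\<close> inverse to \<open>b\<close> and hollow.\<close>
  define s where "s = (\<lambda>i. 1 / sqrt (B $$ (i, i)))"
  have s: "0 < s i" "s i * s i * B $$ (i, i) = 1" if "i < 4" for i
    using diag[OF that] by (simp_all add: s_def)
  define b where "b = (\<lambda>i j. s i * s j * B $$ (i, j))"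
  define a where "a = (\<lambda>i j. A $$ (i, j) / (s i * s j))"
  have inv: "b i 0 * a 0 j + b i 1 * a 1 j + b i 2 * a 2 j + b i 3 * a 3 j = (if i = j then 1 else 0)"
    if "i < 4" "j < 4" for i j
  proof -
    have "(\<Sum>k<4. b i k * a k j) = (\<Sum>k<4. s i / s j * (B $$ (i, k) * A $$ (k, j)))"
      by (rule sum.cong) (use s(1) in \<open>force simp: a_def b_def\<close>)+
    also have "\<dots> = s i / s j * (B * A) $$ (i, j)"
      using that B A4 by (simp add: scalar_prod_def lessThan_atLeast0 sum_distrib_left)
    also have "\<dots> = (if i = j then 1 else 0)"
      using that A(2) s(1)[OF that(1)] s(1)[OF that(2)] by auto
    finally show ?thesis by (simp add: eval_nat_numeral)
  qed
  have b_diag: "b i i = 1" if "i < 4" for i using s(2)[OF that] by (simp add: b_def)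
  have b_sym: "b i j = b j i" if "i < 4" "j < 4" for i j using sym[OF that] by (simp add: b_def)
  have a_diag: "a i i = 0" if "i < 4" for i using hollow[OF that] by (simp add: a_def)
  have a_sym: "a i j = a j i" if "i < 4" "j < 4" for i j using symA[OF that] by (simp add: a_def)
  have b_le: "(b i j)\<^sup>2 \<le> 1" if "i < 4" "j < 4" for i j
  proof -
    have "(b i j)\<^sup>2 = (s i * s j)\<^sup>2 * (B $$ (i, j))\<^sup>2" by (simp add: b_def power_mult_distrib)
    also have "\<dots> \<le> (s i * s j)\<^sup>2 * (B $$ (i, i) * B $$ (j, j))"
      using minors[OF that] by (intro mult_left_mono) auto
    also have "\<dots> = (s i * s i * B $$ (i, i)) * (s j * s j * B $$ (j, j))"
      by (simp add: power2_eq_square algebra_simps)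
    finally show ?thesis using s(2) that by simp
  qed
  \<comment> \<open>The instances move every entry below the diagonal to its mirror image above
    it.\<close>
  note norm = b_diag a_diag b_sym[of 1 0] b_sym[of 2 0] b_sym[of 3 0] b_sym[of 2 1] b_sym[of 3 1]
    b_sym[of 3 2] a_sym[of 1 0] a_sym[of 2 0] a_sym[of 3 0] a_sym[of 2 1] a_sym[of 3 1] a_sym[of 3 2]
  have "\<exists>e. (e = 1 \<or> e = - 1) \<and> b 0 1 = e * b 2 3 \<and> b 0 2 = e * b 1 3 \<and> b 0 3 = e * b 1 2 \<and>
    (b 2 3)\<^sup>2 < 1 \<and> (b 1 2)\<^sup>2 < 1 \<and>
    (b 1 3 - b 2 3 * b 1 2)\<^sup>2 = (1 - (b 2 3)\<^sup>2) * (1 - (b 1 2)\<^sup>2)"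
    by (rule unit_diagonal_with_hollow_inverse[of "b 0 1" "a 0 1" "b 0 2" "a 0 2"
          "b 0 3" "a 0 3" "a 1 2" "a 1 3" "a 2 3" "b 1 2" "b 1 3" "b 2 3"])
      (use inv[of 0 0] inv[of 0 1] inv[of 0 2] inv[of 0 3]
        inv[of 1 0] inv[of 1 1] inv[of 1 2] inv[of 1 3]
        inv[of 2 0] inv[of 2 1] inv[of 2 2] inv[of 2 3]
        inv[of 3 0] inv[of 3 1] inv[of 3 2] inv[of 3 3] b_le[of 2 3] b_le[of 1 2]
        in \<open>simp_all add: norm del: One_nat_def\<close>)
  then obtain e where e: "e = 1 \<or> e = - 1"
      "b 0 1 = e * b 2 3" "b 0 2 = e * b 1 3" "b 0 3 = e * b 1 2"
    and "(b 2 3)\<^sup>2 < 1" "(b 1 2)\<^sup>2 < 1"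
      "(b 1 3 - b 2 3 * b 1 2)\<^sup>2 = (1 - (b 2 3)\<^sup>2) * (1 - (b 1 2)\<^sup>2)"
    by blast
  then obtain \<alpha> \<gamma> where angles: "\<alpha> \<in> {-pi<..<pi} - {0}" "\<gamma> \<in> {-pi<..<pi} - {0}"
    and b: "b 2 3 = cos \<alpha>" "b 1 2 = cos \<gamma>" "b 1 3 = cos (\<alpha> - \<gamma>)"
    using arccos_parametrization by blast
  \<comment> \<open>The common sign \<open>e\<close> is absorbed by the first diagonal entry: it
    flips the first row and column of \<open>b\<close> and cancels on the diagonal.\<close>
  define d where "d = (\<lambda>i::nat. if i = 0 then e * s i else s i)"
  define D where "D = mat_diag 4 d"
  have d_nz: "d i \<noteq> 0" if "i < 4" for i
    using s(1)[OF that] e(1) by (auto simp: d_def)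
  have D: "D \<in> carrier_mat 4 4" by (simp add: D_def)
  define D' where "D' = mat_diag 4 (\<lambda>i. 1 / d i)"
  have "D * D' = 1\<^sub>m 4" "D' * D = 1\<^sub>m 4"
    unfolding D_def D'_def mat_diag_diag
    using d_nz by (auto simp: mat_diag_def intro!: eq_matI)
  then have "invertible_mat D"
    using D by (auto simp: invertible_mat_def inverts_mat_def D'_def mat_diag_def)
  moreover have "diagonal_mat D" by (auto simp: diagonal_mat_def D_def mat_diag_def)
  moreover have "permutation_mat 4 (1\<^sub>m 4)"
    unfolding permutation_mat_def by (intro exI[of _ id]) (auto simp: permutes_id)
  moreover have "D * 1\<^sub>m 4 * B * (1\<^sub>m 4)\<^sup>T * D = mat 4 4 (\<lambda>(i, j). d i * B $$ (i, j) * d j)"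
  proof -
    have "D * 1\<^sub>m 4 * B * (1\<^sub>m 4)\<^sup>T * D = D * B * D"
      using D B by simp
    also have "\<dots> = mat 4 4 (\<lambda>(i, j). d i * B $$ (i, j) * d j)"
      unfolding D_def mat_diag_mult_left[OF B] by (subst mat_diag_mult_right[of _ 4]) (auto intro!: eq_matI)
    finally show ?thesis .
  qed
  moreover have "mat 4 4 (\<lambda>(i, j). d i * B $$ (i, j) * d j) = mat_of_rows_list 4
      [[1,           cos \<alpha>,       cos (\<alpha> - \<gamma>), cos \<gamma>],
       [cos \<alpha>,       1,           cos \<gamma>,       cos (\<alpha> - \<gamma>)],
       [cos (\<alpha> - \<gamma>), cos \<gamma>,       1,           cos \<alpha>],
       [cos \<gamma>,       cos (\<alpha> - \<gamma>), cos \<alpha>,       1]]" (is "?L = ?R")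
  proof (rule eq_matI)
    fix i j assume "i < dim_row ?R" "j < dim_col ?R"
    then have ij: "i < 4" "j < 4" by (simp_all add: mat_of_rows_list_def)
    define g where "g = (\<lambda>i::nat. if i = 0 then e else 1)"
    have "?L $$ (i, j) = g i * g j * b i j"
      using ij by (simp add: d_def g_def b_def)
    also have "\<dots> = ?R $$ (i, j)"
    proof -
      have "e * e = 1" using e(1) by auto
      then have ee: "e * (e * x) = x" for x by (simp flip: mult.assoc)
      have "i = 0 \<or> i = 1 \<or> i = 2 \<or> i = 3" "j = 0 \<or> j = 1 \<or> j = 2 \<or> j = 3"
        using ij by presburger+
      then show ?thesis
        by (elim disjE) (simp_all add: mat_of_rows_list_def nth_Cons' g_def norm e(2-4) b ee
            \<open>e * e = 1\<close> del: One_nat_def)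
    qed
    finally show "?L $$ (i, j) = ?R $$ (i, j)" .
  qed (simp_all add: mat_of_rows_list_def)
  ultimately show ?thesis
    using angles D
    by - (rule bexI[of _ \<alpha>], rule bexI[of _ \<gamma>], rule exI[of _ "1\<^sub>m 4"], rule exI[of _ D], simp_all only:)
qed

end
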